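(* Let $\lambda>0$, $V>0$, $c_1\ge0$, $\theta_{\mathrm{up}}>0$, let $F_\Theta$ be the cumulative distribution function of the uniform distribution on $[0,\theta_{\mathrm{up}}]$, and let $\mathbf{E}[T(p)]$ be the mean queueing delay defined in the context. Let $\alpha\in(0,1]$, and let $p_1^0\in[0,1]$ be any starting point. Consider the adaptive-expectations dynamics $$p_1^{t+1}=(1-\alpha)\,p_1^{t}+\alpha\,F_\Theta\bigl(\theta_1(p_1^t)\bigr),\quad t=0,1,2,\dots,\qquad \theta_1(p)=\frac{V-c_1}{\mathbf{E}[T(p)]}.$$ If $$\frac{\mathbf{E}'[T(1)]}{\mathbf{E}[T(1)]}<\frac1\alpha ,$$ where $\mathbf{E}'[T(1)]$ is the derivative of $p\mapsto\mathbf{E}[T(p)]$ at $p=1$, then $p_1^t$ converges as $t\to\infty$ to the equilibrium joining probability $p_1^*$, i.e. the unique $p_1^*\in[0,1]$ with $p_1^*=F_\Theta(\theta_1(p_1^* ))$.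
   Context: Secondary users (SUs) arrive according to a Poisson process of rate $\lambda>0$. Each SU carries a job with random service time $X>0$. Its type $\theta$ (delay sensitivity) is drawn from the uniform distribution on $[0,\theta_{\mathrm{up}}]$, with cumulative distribution function $F_\Theta$ (so $F_\Theta(x)=0$ for $x\le 0$, $F_\Theta(x)=x/\theta_{\mathrm{up}}$ on $[0,\theta_{\mathrm{up}}]$, and $F_\Theta(x)=1$ for $x\ge\theta_{\mathrm{up}}$). The shared-use operator has a single channel alternating between ON periods (i.i.d. copies $Y_i$ of $Y>0$, during which SU service is interrupted) and OFF periods (i.i.d. copies of $Z>0$), independent of SU arrivals and service times. The effective service time is $X_e=X+\sum_{i=1}^{N(X)}Y_i$, where $N(X)$ is the number of ON periods interrupting the service. One has $\mathbf{E}[X_e]=\mathbf{E}[X]\,(1+\mathbf{E}[Y]/\mathbf{E}[Z])$, and $\mathbf{E}[X_e]$, $\mathbf{E}[X_e^2]$ are positive and finite. If a fraction $p\in[0,1]$ of SUs joins, the mean queueing delay is given by the extended-value M/G/1 formula $$\mathbf{E}[T(p)]=\begin{cases}\dfrac{\lambda p\,\mathbf{E}[X_e^2]}{2(1-\lambda p\,\mathbf{E}[X_e])}+\mathbf{E}[X_e], & \lambda p<1/\mathbf{E}[X_e],\\[2mm] \infty, & \text{otherwise,}\end{cases}$$ with the convention $a/\infty=0$. $\mathbf{E}'[T(p)]$ denotes the derivative of $\mathbf{E}[T(p)]$ with respect to $p$ (given by the finite formula). If $\lambda\ge 1/\mathbf{E}[X_e]$, the ratio $\mathbf{E}'[T(1)]/\mathbf{E}[T(1)]$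 is interpreted as $+\infty$, so the displayed condition is then violated. $V$ is the service reward, $c_1$ is the admission price, and $p_1^t$ is the fraction of SUs joining in period $t$. *)

theory Defs
  imports "HOL-Probability.Probability"
begin

text \<open>
  A job of length \<open>X\<close> is served only while the channel is OFF.  We measure time by the amount of
  service (OFF time) received since the start of the service: the first ON period occurs at \<open>R\<close>, the
  remainder of the OFF period in progress when service starts, and two consecutive ON periods are
  separated by a full OFF period.  No distribution is imposed on \<open>R\<close>, so \<open>R\<close> may be distributed
  like the OFF periods or like their stationary residual.  The \<open>k\<close>-th ON period (counted from \<open>0\<close>)
  thus occurs after \<open>R + Z 0 + \<dots> + Z (k - 1)\<close> units of service.  The set below is almost
  surely finite for the i.i.d. positive OFF periods assumed later.
\<close>

definition interruptions ::
  "('a \<Rightarrow> real) \<Rightarrow> (nat \<Rightarrow> 'a \<Rightarrow> real) \<Rightarrow> real \<Rightarrow> 'a \<Rightarrow> nat" where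
  "interruptions R Z x \<omega> = card {k. R \<omega> + (\<Sum>j<k. Z j \<omega>) < x}"

definition effective_service_time ::
  "('a \<Rightarrow> real) \<Rightarrow> ('a \<Rightarrow> real) \<Rightarrow> (nat \<Rightarrow> 'a \<Rightarrow> real) \<Rightarrow> (nat \<Rightarrow> 'a \<Rightarrow> real) \<Rightarrow> 'a \<Rightarrow> real" where
  "effective_service_time X R Y Z \<omega> = X \<omega> + (\<Sum>i<interruptions R Z (X \<omega>) \<omega>. Y i \<omega>)"

text \<open>
  \<open>Y\<close> are the ON periods and \<open>Z\<close> the OFF periods.  Independence of the service time and the channel
  is stated for the generated sigma algebras, because \<open>indep_var\<close> requires both random variables to
  have the same value type.
\<close>

locale shared_channel = prob_space M
  for M :: "'a measure" +
  fixes X R :: "'a \<Rightarrow> real" and Y Z :: "nat \<Rightarrow> 'a \<Rightarrow> real"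
  assumes X_pos: "AE \<omega> in M. X \<omega> > 0"
    and R_nonneg: "AE \<omega> in M. R \<omega> \<ge> 0"
    and Y_pos: "AE \<omega> in M. Y 0 \<omega> > 0"
    and Z_pos: "AE \<omega> in M. Z 0 \<omega> > 0"
    and Y_indep: "indep_vars (\<lambda>_. borel) Y UNIV"
    and Y_ident: "\<And>i. distr M borel (Y i) = distr M borel (Y 0)"
    and Z_indep: "indep_vars (\<lambda>_. borel) Z UNIV"
    and Z_ident: "\<And>i. distr M borel (Z i) = distr M borel (Z 0)"
    and R_measurable: "R \<in> borel_measurable M"
    and service_indep_channel:
      "indep_set
         (sets (vimage_algebra (space M) X borel))
         (sets (vimage_algebra (space M) (\<lambda>\<omega>. (R \<omega>, (\<lambda>i. Y i \<omega>), (\<lambda>i. Z i \<omega>)))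
            (borel \<Otimes>\<^sub>M ((\<Pi>\<^sub>M i\<in>UNIV. borel) \<Otimes>\<^sub>M (\<Pi>\<^sub>M i\<in>UNIV. borel)))))"
    and X_integrable: "integrable M X"
    and Y_integrable: "integrable M (Y 0)"
    and Z_integrable: "integrable M (Z 0)"
    and effective_mean:
      "expectation (effective_service_time X R Y Z) =
         expectation X * (1 + expectation (Y 0) / expectation (Z 0))"
    and effective_integrable: "integrable M (effective_service_time X R Y Z)"
    and effective_sq_integrable: "integrable M (\<lambda>\<omega>. (effective_service_time X R Y Z \<omega>)\<^sup>2)"
    and effective_mean_pos: "expectation (effective_service_time X R Y Z) > 0"
    and effective_sq_mean_pos: "expectation (\<lambda>\<omega>. (effective_service_time X R Y Z \<omega>)\<^sup>2) > 0"

text \<open>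
  In the following \<open>S\<close> is the effective service time and \<open>lam\<close> the arrival rate, so that the
  joining users arrive at rate \<open>lam * p\<close>.
\<close>

definition finite_delay :: "real \<Rightarrow> 'a measure \<Rightarrow> ('a \<Rightarrow> real) \<Rightarrow> real \<Rightarrow> real" where
  "finite_delay lam M S p =
     lam * p * (\<integral>\<omega>. (S \<omega>)\<^sup>2 \<partial>M) / (2 * (1 - lam * p * (\<integral>\<omega>. S \<omega> \<partial>M))) + (\<integral>\<omega>. S \<omega> \<partial>M)"

definition mean_delay :: "real \<Rightarrow> 'a measure \<Rightarrow> ('a \<Rightarrow> real) \<Rightarrow> real \<Rightarrow> ereal" where
  "mean_delay lam M S p =
     (if lam * p < 1 / (\<integral>\<omega>. S \<omega> \<partial>M) then ereal (finite_delay lam M S p) else \<infinity>)"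

definition delay_ratio_at_1 :: "real \<Rightarrow> 'a measure \<Rightarrow> ('a \<Rightarrow> real) \<Rightarrow> ereal" where
  "delay_ratio_at_1 lam M S =
     (if lam < 1 / (\<integral>\<omega>. S \<omega> \<partial>M)
      then ereal (deriv (finite_delay lam M S) 1) / mean_delay lam M S 1 else \<infinity>)"

text \<open>
  The quotient is taken in the extended reals, where division by \<open>\<infinity>\<close> gives \<open>0\<close>; it is
  finite for \<open>p \<ge> 0\<close>, where the delay is at least the mean of \<open>S\<close>.
\<close>

definition threshold_type ::
  "real \<Rightarrow> 'a measure \<Rightarrow> ('a \<Rightarrow> real) \<Rightarrow> real \<Rightarrow> real \<Rightarrow> real \<Rightarrow> real" where
  "threshold_type lam M S V c p = real_of_ereal (ereal (V - c) / mean_delay lam M S p)"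

definition type_cdf :: "real \<Rightarrow> real \<Rightarrow> real" where
  "type_cdf up = cdf (uniform_measure lborel {0..up})"

definition joining_equilibrium ::
  "real \<Rightarrow> 'a measure \<Rightarrow> ('a \<Rightarrow> real) \<Rightarrow> real \<Rightarrow> real \<Rightarrow> real \<Rightarrow> real \<Rightarrow> bool" where
  "joining_equilibrium lam M S V c up p \<longleftrightarrow>
     p \<in> {0..1} \<and> p = type_cdf up (threshold_type lam M S V c p)"

end

theory Submission
  imports Defs
begin

text \<open>
  On \<open>[0,1]\<close> the dynamics is \<open>f p = (1 - \<alpha>) p + \<alpha> G p\<close> with \<open>G\<close> nonincreasing, so the unique fixed
  point \<open>z\<close> of \<open>G\<close> attracts points in the sense that \<open>f p > p\<close> below \<open>z\<close> and \<open>f p < p\<close> above it.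
  Such an orbit can fail to converge only by overshooting: the preimages \<open>v\<close>, \<open>w\<close> of its largest and
  smallest accumulation points would satisfy \<open>v < z < w \<le> f v\<close> and \<open>f w \<le> v\<close>.  Since the product of
  \<open>G\<close> and the delay \<open>T\<close> is nondecreasing, this would force
  \<open>(w - (1 - \<alpha>) v) T v \<le> (v - (1 - \<alpha>) w) T w\<close>.  Because \<open>T p = m + D p / (1 - a p)\<close>, the
  opposite strict inequality reduces to its limiting case \<open>v = w = 1\<close>, which follows from
  \<open>T' 1 / T 1 < 1 / \<alpha>\<close>.  The local condition at \<open>1\<close> thus suffices globally although \<open>T' / T\<close> need
  not be monotone.
\<close>

text \<open>The predecessors of the terms converging to \<open>y\<close> have a convergent
  subsequence by compactness, and continuity of \<open>f\<close> carries its limit \<open>v\<close>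
  to \<open>y\<close>. The subsequence \<open>q\<close> is returned so that \<open>v\<close> is
  itself known to be an accumulation point.\<close>

lemma accumulation_point_preimage:
  fixes f :: "real \<Rightarrow> real" and x :: "nat \<Rightarrow> real"
  assumes cont: "continuous_on {a..b} f"
    and mem: "\<And>n. x n \<in> {a..b}" and orbit: "\<And>n. x (Suc n) = f (x n)"
    and r: "strict_mono r" and lim: "(\<lambda>n. x (r n)) \<longlonglongrightarrow> y"
  obtains v q where "v \<in> {a..b}" "f v = y" "strict_mono q" "(\<lambda>n. x (q n)) \<longlonglongrightarrow> v"
proof -
  \<comment> \<open>Starting from \<open>r (Suc n)\<close> rather than \<open>r n\<close> keeps the
    index positive, so truncated subtraction yields a true predecessor.\<close>
  have "\<forall>n. x (r (Suc n) - 1) \<in> {a..b}" using mem by blast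
  then obtain v s where v: "v \<in> {a..b}" and s: "strict_mono s"
    and sv: "((\<lambda>n. x (r (Suc n) - 1)) \<circ> s) \<longlonglongrightarrow> v"
    using compact_Icc[of a b] unfolding compact_def by meson
  define q where "q n = r (Suc (s n)) - 1" for n
  have pos: "0 < r (Suc n)" for n
    using r by (metis gr_zeroI not_less_zero strict_mono_less zero_less_Suc)
  have Suc_q: "Suc (q n) = r (Suc (s n))" for n
    using pos[of "s n"] by (simp add: q_def)
  have q: "strict_mono q"
  proof (rule strict_monoI)
    fix m n :: nat assume "m < n"
    then have "Suc (q m) < Suc (q n)"
      unfolding Suc_q using r s by (simp add: strict_mono_less)
    then show "q m < q n" by simp
  qed
  have qv: "(\<lambda>n. x (q n)) \<longlonglongrightarrow> v" using sv by (simp add: q_def o_def)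
  have "(\<lambda>n. f (x (q n))) \<longlonglongrightarrow> f v"
    using continuous_on_tendsto_compose[OF cont qv v] mem by simp
  moreover have "(\<lambda>n. f (x (q n))) \<longlonglongrightarrow> y"
  proof -
    have "strict_mono (\<lambda>n. Suc (s n))" using s by (simp add: strict_mono_def)
    from LIMSEQ_subseq_LIMSEQ[OF lim this] show ?thesis
      by (simp add: o_def orbit[symmetric] Suc_q)
  qed
  ultimately have "f v = y" by (rule LIMSEQ_unique)
  with v q qv show thesis using that by blast
qed

lemma orbit_tendsto_fixed_point:
  fixes f :: "real \<Rightarrow> real" and x :: "nat \<Rightarrow> real"
  assumes cont: "continuous_on {a..b} f"
    and mem: "\<And>n. x n \<in> {a..b}" and orbit: "\<And>n. x (Suc n) = f (x n)"
    and fixed: "f z = z"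
    and below: "\<And>y. y \<in> {a..b} \<Longrightarrow> y < z \<Longrightarrow> y < f y"
    and above: "\<And>y. y \<in> {a..b} \<Longrightarrow> z < y \<Longrightarrow> f y < y"
    and no_overshoot: "\<And>v w. \<lbrakk>v \<in> {a..b}; w \<in> {a..b}; v < z; z < w; w \<le> f v\<rbrakk> \<Longrightarrow> v < f w"
  shows "x \<longlonglongrightarrow> z"
proof -
  let ?X = "\<lambda>n. ereal (x n)"
  have lo: "ereal a \<le> liminf ?X" using mem by (intro Liminf_bounded) auto
  have hi: "limsup ?X \<le> ereal b" using mem by (intro Limsup_bounded) auto
  have le: "liminf ?X \<le> limsup ?X" by (simp add: Liminf_le_Limsup)
  obtain l where l: "liminf ?X = ereal l"
    using lo hi le by (cases "liminf ?X") auto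
  obtain u where u: "limsup ?X = ereal u"
    using lo hi le by (cases "limsup ?X") auto
  have between: "l \<le> y \<and> y \<le> u" if "strict_mono r" "(\<lambda>n. x (r n)) \<longlonglongrightarrow> y" for r y
  proof -
    have lim: "(?X \<circ> r) \<longlonglongrightarrow> ereal y" using that(2) by (simp add: o_def)
    have "liminf ?X \<le> ereal y"
      using liminf_subseq_mono[OF that(1), of ?X] lim_imp_Liminf[OF _ lim] by simp
    moreover have "ereal y \<le> limsup ?X"
      using limsup_subseq_mono[OF that(1), of ?X] lim_imp_Limsup[OF _ lim] by simp
    ultimately show ?thesis using l u by simp
  qed
  obtain r where "strict_mono r" "(\<lambda>n. x (r n)) \<longlonglongrightarrow> u"
    using limsup_subseq_lim[of ?X] u by (auto simp: o_def)
  from accumulation_point_preimage[OF cont mem orbit this]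
  obtain v where v: "v \<in> {a..b}" "f v = u" "l \<le> v" "v \<le> u"
    using between by metis
  obtain r where "strict_mono r" "(\<lambda>n. x (r n)) \<longlonglongrightarrow> l"
    using liminf_subseq_lim[of ?X] l by (auto simp: o_def)
  from accumulation_point_preimage[OF cont mem orbit this]
  obtain w where w: "w \<in> {a..b}" "f w = l" "l \<le> w" "w \<le> u"
    using between by metis
  \<comment> \<open>If \<open>v > z\<close>, then \<open>u = f v < v \<le> u\<close>, which is
    absurd; the bound on \<open>w\<close> is symmetric.\<close>
  have "v \<le> z" using above[of v] v by fastforce
  have "z \<le> w" using below[of w] w by fastforce
  \<comment> \<open>Since \<open>w \<le> u = f v\<close>, the hypothesis would give
    \<open>v < f w = l\<close>, against \<open>l \<le> v\<close>.\<close>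
  have "\<not> (v < z \<and> z < w)" using no_overshoot[of v w] v w by auto
  \<comment> \<open>If \<open>v = z\<close>, then \<open>u = f z = z\<close>, so
    \<open>z \<le> w \<le> u\<close> gives \<open>w = z\<close> and \<open>l = z\<close>; the case
    \<open>w = z\<close> is symmetric.\<close>
  then have "u = z \<and> l = z"
    using \<open>v \<le> z\<close> \<open>z \<le> w\<close> fixed v w by fastforce
  then show ?thesis
    using l u limsup_le_liminf_real[of x z] by simp
qed

text \<open>\<open>T\<close> does not enter the recursion. It is a weight that turns the
  nonincreasing \<open>G\<close> into the nondecreasing \<open>G * T\<close>, which makes bounds on
  \<open>G\<close> at two different points comparable.\<close>

lemma adaptive_dynamics_tendsto:
  fixes G T :: "real \<Rightarrow> real" and x :: "nat \<Rightarrow> real"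
  assumes cont: "continuous_on {0..1} G"
    and range: "\<And>y. y \<in> {0..1} \<Longrightarrow> G y \<in> {0..1}"
    and anti: "\<And>y y'. \<lbrakk>y \<in> {0..1}; y' \<in> {0..1}; y \<le> y'\<rbrakk> \<Longrightarrow> G y' \<le> G y"
    and T_pos: "\<And>y. y \<in> {0..1} \<Longrightarrow> 0 < T y"
    and GT_mono: "\<And>y y'. \<lbrakk>y \<in> {0..1}; y' \<in> {0..1}; y \<le> y'\<rbrakk> \<Longrightarrow> G y * T y \<le> G y' * T y'"
    and no_cycle: "\<And>v w. \<lbrakk>0 \<le> v; v < w; w \<le> 1\<rbrakk> \<Longrightarrow>
      (v - (1 - \<alpha>) * w) * T w < (w - (1 - \<alpha>) * v) * T v"
    and \<alpha>: "0 < \<alpha>" "\<alpha> \<le> 1"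
    and start: "x 0 \<in> {0..1}"
    and step: "\<And>n. x (Suc n) = (1 - \<alpha>) * x n + \<alpha> * G (x n)"
  shows "\<exists>z. (z \<in> {0..1} \<and> z = G z) \<and> (\<forall>q. q \<in> {0..1} \<and> q = G q \<longrightarrow> q = z) \<and> x \<longlonglongrightarrow> z"
proof -
  \<comment> \<open>The function \<open>y - G y\<close> is at most 0 at 0 and at least 0 at
    1.\<close>
  have "\<exists>z\<ge>0. z \<le> 1 \<and> z - G z = 0"
    using range[of 0] range[of 1]
    by (intro IVT') (auto intro!: continuous_intros cont)
  then obtain z where z: "z \<in> {0..1}" "z = G z" by auto
  have unique: "q = z" if "q \<in> {0..1}" "q = G q" for q
    using anti[of q z] anti[of z q] that z by fastforce
  let ?f = "\<lambda>y. (1 - \<alpha>) * y + \<alpha> * G y"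
  have f_diff: "?f y - y = \<alpha> * (G y - y)" for y by algebra
  have mem: "x n \<in> {0..1}" for n
  proof (induction n)
    case (Suc n)
    have "(1 - \<alpha>) * x n + \<alpha> * G (x n) \<in> {0..1}"
      using convexD_alt[OF convex_real_interval(5), OF Suc range[OF Suc], of \<alpha>] \<alpha> by simp
    then show ?case by (simp only: step)
  qed (rule start)
  have "x \<longlonglongrightarrow> z"
  proof (rule orbit_tendsto_fixed_point[where f = ?f and a = 0 and b = 1])
    show "continuous_on {0..1} ?f" by (intro continuous_intros cont)
    show "?f z = z" using f_diff[of z] z by simp
    show "y < ?f y" if "y \<in> {0..1}" "y < z" for y
    proof -
      have "0 < \<alpha> * (G y - y)" using anti[of y z] that z \<alpha> by simp
      then show ?thesis using f_diff[of y] by linarith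
    qed
    show "?f y < y" if "y \<in> {0..1}" "z < y" for y
    proof -
      have "0 < \<alpha> * (y - G y)" using anti[of z y] that z \<alpha> by simp
      then show ?thesis using f_diff[of y] by (simp add: algebra_simps)
    qed
    show "v < ?f w" if vw: "v \<in> {0..1}" "w \<in> {0..1}" "v < z" "z < w" "w \<le> ?f v" for v w
    proof (rule ccontr)
      assume "\<not> v < ?f w"
      then have w: "\<alpha> * G w \<le> v - (1 - \<alpha>) * w" by simp
      \<comment> \<open>The overshoot \<open>w \<le> ?f v\<close> bounds
        \<open>\<alpha> * G v\<close> from below, and the negated goal bounds
        \<open>\<alpha> * G w\<close> from above.\<close>
      have "(w - (1 - \<alpha>) * v) * T v \<le> (\<alpha> * G v) * T v"
        using vw T_pos[of v] by (intro mult_right_mono) auto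
      also have "\<dots> \<le> (\<alpha> * G w) * T w"
        using GT_mono[of v w] vw \<alpha> by (simp add: mult.assoc)
      also have "\<dots> \<le> (v - (1 - \<alpha>) * w) * T w"
        using w vw T_pos[of w] by (intro mult_right_mono) auto
      finally show False using no_cycle[of v w] vw by simp
    qed
  qed (use mem step in auto)
  then show ?thesis using z unique by blast
qed

text \<open>The hypothesis \<open>cond\<close> is \<open>T' 1 / T 1 < 1 / \<alpha>\<close> with
  denominators cleared. The difference of the two sides is a positive multiple of a polynomial
  \<open>?P\<close>, which is at least \<open>v * w\<close> times its value at
  \<open>v = w = 1\<close>.\<close>

lemma delay_no_cycle:
  fixes a D m \<alpha> v w :: real
  defines "T \<equiv> \<lambda>p. D * p / (1 - a * p) + m"
  assumes "0 < m" "0 \<le> D" "0 \<le> a" "a < 1" "0 < \<alpha>" "\<alpha> \<le> 1"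
    and cond: "\<alpha> * D < m * (1 - a)\<^sup>2 + D * (1 - a)"
    and vw: "0 \<le> v" "v < w" "w \<le> 1"
  shows "(v - (1 - \<alpha>) * w) * T w < (w - (1 - \<alpha>) * v) * T v"
proof -
  define \<beta> where "\<beta> = 1 - \<alpha>"
  have \<beta>: "0 \<le> \<beta>" "\<beta> < 1" using assms by (auto simp: \<beta>_def)
  have uv: "v * (1 - a) \<le> 1 - a * v" and uw: "w * (1 - a) \<le> 1 - a * w"
    using vw by (auto simp: algebra_simps)
  have "a * w \<le> a" "a * v \<le> a"
    using vw \<open>0 \<le> a\<close> by (auto intro: mult_left_le)
  then have pv: "0 < 1 - a * v" and pw: "0 < 1 - a * w"
    using \<open>a < 1\<close> by auto
  \<comment> \<open>This is the difference of the two sides with \<open>w - v\<close> factored out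
    and the denominators cleared.\<close>
  let ?P = "m * (1 + \<beta>) * ((1 - a * v) * (1 - a * w)) + D * (\<beta> * (w + v) - (1 + \<beta>) * (a * (v * w)))"
  \<comment> \<open>The bound by \<open>v * w\<close> times the value at one is strict only for
    \<open>v > 0\<close>, so \<open>v = 0\<close> is treated separately.\<close>
  have "0 < ?P"
  proof (cases "v = 0")
    case True
    have "0 < m * (1 + \<beta>) * ((1 - a * v) * (1 - a * w))"
      using \<beta> pv pw \<open>0 < m\<close> by simp
    moreover have "0 \<le> D * (\<beta> * w)" using \<beta> vw \<open>0 \<le> D\<close> by simp
    ultimately show ?thesis using True by simp
  next
    case False
    then have pos: "0 < v * w" using vw by simp
    \<comment> \<open>This is \<open>?P\<close> at \<open>v = w = 1\<close>. It follows from
      \<open>cond\<close> multiplied by \<open>1 + \<beta>\<close>, with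
      \<open>D * (\<beta> * (1 - \<beta>))\<close> to spare.\<close>
    have at_one: "0 < m * (1 + \<beta>) * (1 - a)\<^sup>2 + D * (2 * \<beta> - (1 + \<beta>) * a)"
    proof -
      have "D * (a - \<beta>) < m * (1 - a)\<^sup>2"
        using cond by (simp add: \<beta>_def algebra_simps)
      then have "(1 + \<beta>) * (D * (a - \<beta>)) < (1 + \<beta>) * (m * (1 - a)\<^sup>2)"
        using \<beta> by (intro mult_strict_left_mono) auto
      moreover have "0 \<le> D * (\<beta> * (1 - \<beta>))" using \<beta> \<open>0 \<le> D\<close> by simp
      ultimately show ?thesis by (simp add: algebra_simps)
    qed
    have "v * (1 - a) * (w * (1 - a)) \<le> (1 - a * v) * (1 - a * w)"
      using uv uw pv vw \<open>a < 1\<close> by (intro mult_mono) auto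
    then have 1: "m * (1 + \<beta>) * (v * (1 - a) * (w * (1 - a)))
        \<le> m * (1 + \<beta>) * ((1 - a * v) * (1 - a * w))"
      using \<beta> \<open>0 < m\<close> by (intro mult_left_mono) auto
    have "v * w \<le> v" "v * w \<le> w"
      using vw by (auto intro: mult_left_le mult_left_le_one_le)
    then have 2: "D * (\<beta> * (2 * (v * w))) \<le> D * (\<beta> * (w + v))"
      using \<beta> \<open>0 \<le> D\<close> by (intro mult_left_mono) auto
    have "0 < (v * w) * (m * (1 + \<beta>) * (1 - a)\<^sup>2 + D * (2 * \<beta> - (1 + \<beta>) * a))"
      using pos at_one by (rule mult_pos_pos)
    also have "\<dots> = m * (1 + \<beta>) * (v * (1 - a) * (w * (1 - a))) + D * (\<beta> * (2 * (v * w)))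
        - D * ((1 + \<beta>) * (a * (v * w)))"
      by algebra
    also have "\<dots> \<le> ?P" using 1 2 by (simp add: right_diff_distrib)
    finally show ?thesis .
  qed
  then have "0 < (w - v) * ?P / ((1 - a * v) * (1 - a * w))"
    using vw pv pw by simp
  also have "\<dots> = (w - \<beta> * v) * T v - (v - \<beta> * w) * T w"
    using pv pw unfolding T_def by (simp add: divide_simps) algebra
  finally show ?thesis by (simp add: \<beta>_def)
qed

text \<open>Clamping to the unit interval also covers negative thresholds, which arise when the
  price exceeds the reward.\<close>

lemma type_cdf_eq:
  assumes "0 < up"
  shows "type_cdf up x = max 0 (min 1 (x / up))"
proof -
  have "{0..up} \<inter> {..x} = {0..min up x}" by auto
  then have "type_cdf up x = measure lborel {0..min up x} / up"
    using assms by (simp add: type_cdf_def cdf_def measure_uniform_measure)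
  also have "\<dots> = max 0 (min 1 (x / up))"
    using assms by (auto simp: max_def min_def divide_simps)
  finally show ?thesis .
qed

lemma deriv_finite_delay:
  assumes "lam * p * (\<integral>\<omega>. S \<omega> \<partial>M) \<noteq> 1"
  shows "deriv (finite_delay lam M S) p =
    lam * (\<integral>\<omega>. (S \<omega>)\<^sup>2 \<partial>M) / (2 * (1 - lam * p * (\<integral>\<omega>. S \<omega> \<partial>M))\<^sup>2)"
proof (rule DERIV_imp_deriv)
  define m where "m = (\<integral>\<omega>. S \<omega> \<partial>M)"
  define s where "s = (\<integral>\<omega>. (S \<omega>)\<^sup>2 \<partial>M)"
  have ne: "1 - lam * p * m \<noteq> 0" using assms by (simp add: m_def)
  have "((\<lambda>p. lam * p * s / (2 * (1 - lam * p * m)) + m) has_real_derivative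
      (lam * s * (2 * (1 - lam * p * m)) - lam * p * s * (2 * - (lam * m)))
        / (2 * (1 - lam * p * m) * (2 * (1 - lam * p * m)))) (at p)"
    using ne by (auto intro!: derivative_eq_intros)
  also have "(lam * s * (2 * (1 - lam * p * m)) - lam * p * s * (2 * - (lam * m)))
        / (2 * (1 - lam * p * m) * (2 * (1 - lam * p * m)))
      = (2 * (lam * s)) / (2 * (2 * (1 - lam * p * m)\<^sup>2))"
    by (rule arg_cong2[where f = "(/)"]) algebra+
  also have "\<dots> = lam * s / (2 * (1 - lam * p * m)\<^sup>2)"
    by (rule mult_divide_mult_cancel_left) simp
  finally have "((\<lambda>p. lam * p * s / (2 * (1 - lam * p * m)) + m) has_real_derivative
      lam * s / (2 * (1 - lam * p * m)\<^sup>2)) (at p)" .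
  then show "(finite_delay lam M S has_real_derivative
    lam * (\<integral>\<omega>. (S \<omega>)\<^sup>2 \<partial>M) / (2 * (1 - lam * p * (\<integral>\<omega>. S \<omega> \<partial>M))\<^sup>2)) (at p)"
    by (simp add: finite_delay_def[abs_def] m_def s_def)
qed

theorem theorem2:
  fixes M :: "'a measure" and X R :: "'a \<Rightarrow> real" and Y Z :: "nat \<Rightarrow> 'a \<Rightarrow> real"
    and lam V c1 up \<alpha> :: real and p :: "nat \<Rightarrow> real"
  defines "Xe \<equiv> effective_service_time X R Y Z"
  assumes "shared_channel M X R Y Z"
    and "lam > 0" and "V > 0" and "c1 \<ge> 0" and "up > 0"
    and "0 < \<alpha>" and "\<alpha> \<le> 1"
    and "0 \<le> p 0" and "p 0 \<le> 1"
    and "\<And>t. p (Suc t) = (1 - \<alpha>) * p t + \<alpha> * type_cdf up (threshold_type lam M Xe V c1 (p t))"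
    and "delay_ratio_at_1 lam M Xe < ereal (1 / \<alpha>)"
  shows "\<exists>pstar. joining_equilibrium lam M Xe V c1 up pstar \<and>
           (\<forall>q. joining_equilibrium lam M Xe V c1 up q \<longrightarrow> q = pstar) \<and>
           p \<longlonglongrightarrow> pstar"
proof -
  define m where "m = (\<integral>\<omega>. Xe \<omega> \<partial>M)"
  define s where "s = (\<integral>\<omega>. (Xe \<omega>)\<^sup>2 \<partial>M)"
  have m: "0 < m" and s: "0 < s"
    using shared_channel.effective_mean_pos[OF assms(2)]
      shared_channel.effective_sq_mean_pos[OF assms(2)]
    by (simp_all add: m_def s_def Xe_def)
  define a where "a = lam * m"
  define D where "D = lam * s / 2"
  define T where "T p = D * p / (1 - a * p) + m" for p
  define G where "G p = type_cdf up (threshold_type lam M Xe V c1 p)" for p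
  have T: "finite_delay lam M Xe = T"
    unfolding finite_delay_def[abs_def] T_def[abs_def] m_def[symmetric] s_def[symmetric] a_def D_def
    by (rule ext) (simp add: divide_simps mult_ac)
  \<comment> \<open>Otherwise the ratio is \<open>\<infinity>\<close> by definition. Hence the queue
    is stable even when everyone joins, and the delay is finite on all of
    \<open>{0..1}\<close>.\<close>
  have lam_less: "lam < 1 / m"
    using assms(12) by (auto simp: delay_ratio_at_1_def m_def split: if_splits)
  have D: "0 < D" and a: "0 < a" "a < 1"
    using \<open>lam > 0\<close> m s lam_less by (simp_all add: D_def a_def field_simps)
  have stable: "a * q < 1" if "q \<in> {0..1}" for q
  proof -
    have "a * q \<le> a" using that a by (intro mult_left_le) auto
    then show ?thesis using a by linarith
  qed
  have delay: "mean_delay lam M Xe q = ereal (T q)" if "q \<in> {0..1}" for q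
    using stable[OF that] m unfolding mean_delay_def T m_def[symmetric]
    by (simp add: a_def field_simps)
  have T_pos: "0 < T q" if "q \<in> {0..1}" for q
    using stable[OF that] that D m by (auto simp: T_def intro!: add_nonneg_pos)
  have T_mono: "T q \<le> T q'" if "q \<in> {0..1}" "q' \<in> {0..1}" "q \<le> q'" for q q'
    unfolding T_def using stable that D a
    by (intro add_right_mono frac_le mult_left_mono) (auto intro!: mult_left_mono)
  have T_cont: "continuous_on {0..1} T"
    unfolding T_def[abs_def] using stable by (intro continuous_intros) force
  have cond: "\<alpha> * D < m * (1 - a)\<^sup>2 + D * (1 - a)"
  proof -
    have "deriv (finite_delay lam M Xe) 1 = D / (1 - a)\<^sup>2"
      using deriv_finite_delay[of lam 1 M Xe] a by (simp add: D_def a_def m_def s_def)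
    then have "D / (1 - a)\<^sup>2 / T 1 < 1 / \<alpha>"
      using assms(12) lam_less T_pos[of 1] delay[of 1]
      by (simp add: delay_ratio_at_1_def m_def)
    then have "\<alpha> * D < (1 - a)\<^sup>2 * T 1"
      using T_pos[of 1] a \<open>0 < \<alpha>\<close> by (simp add: field_simps)
    also have "\<dots> = m * (1 - a)\<^sup>2 + D * (1 - a)"
      using a by (simp add: T_def field_simps power2_eq_square)
    finally show ?thesis .
  qed
  define K where "K = (V - c1) / up"
  have G: "G q = max 0 (min 1 (K / T q))" if "q \<in> {0..1}" for q
    using type_cdf_eq[OF \<open>up > 0\<close>] delay[OF that] T_pos[OF that]
    by (simp add: G_def threshold_type_def K_def mult.commute)
  \<comment> \<open>In this form \<open>T q\<close> occurs only inside \<open>min\<close>, so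
    monotonicity of \<open>T\<close> passes to the product.\<close>
  have GT: "G q * T q = max 0 (min (T q) K)" if "q \<in> {0..1}" for q
    using T_pos[OF that] by (auto simp: G[OF that] max_def min_def field_simps)
  have "\<exists>z. (z \<in> {0..1} \<and> z = G z) \<and> (\<forall>q. q \<in> {0..1} \<and> q = G q \<longrightarrow> q = z) \<and> p \<longlonglongrightarrow> z"
  proof (rule adaptive_dynamics_tendsto[where T = T and \<alpha> = \<alpha>])
    have "continuous_on {0..1} (\<lambda>q. max 0 (min 1 (K / T q)))"
      using T_pos by (intro continuous_intros T_cont) force
    then show "continuous_on {0..1} G"
      by (rule continuous_on_eq) (simp add: G)
    \<comment> \<open>For \<open>K < 0\<close> the quotient \<open>K / T q\<close> is not
      nonincreasing, but it is negative and the clamp sends it to 0.\<close>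
    show "G q' \<le> G q" if "q \<in> {0..1}" "q' \<in> {0..1}" "q \<le> q'" for q q'
    proof (cases "0 \<le> K")
      case True
      then have "K / T q' \<le> K / T q"
        using T_mono[OF that] T_pos that by (intro divide_left_mono) auto
      then show ?thesis using that by (auto simp: G)
    next
      case False
      then have "K / T q' \<le> 0"
        using T_pos[of q'] that by (simp add: divide_nonpos_pos)
      then show ?thesis using that by (auto simp: G)
    qed
    show "G q * T q \<le> G q' * T q'" if "q \<in> {0..1}" "q' \<in> {0..1}" "q \<le> q'" for q q'
      using T_mono[OF that] that by (auto simp: GT)
    show "(v - (1 - \<alpha>) * w) * T w < (w - (1 - \<alpha>) * v) * T v"
      if "0 \<le> v" "v < w" "w \<le> 1" for v w
      using delay_no_cycle[OF m _ _ _ _ _ cond that] D a assms by (simp add: T_def)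
  qed (use assms G T_pos in \<open>auto simp: G_def\<close>)
  then show ?thesis by (simp add: joining_equilibrium_def G_def)
qed

end
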